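(* Let $p,q$ be real numbers with $2\le p\le q<+\infty$. Then for all nonnegative real sequences $x=\{x_n\}$, $y=\{y_n\}$ in $l_p$ (respectively, for all nonnegative real-valued functions $x,y$ in $L_p(\mu)$, for any measure space $(X,\Sigma,\mu)$ with a positive measure $\mu$) we have $$2\big(\Vert x\Vert_p^q+\Vert y\Vert_p^q\big)\le \Vert x+y\Vert_p^q+\Vert x-y\Vert_p^q.$$
   Context: For $1\le p<+\infty$, $l_p$ is the space of sequences $a=\{a_n\}$ with $\sum_{n\ge1}|a_n|^p<+\infty$, normed by $\Vert a\Vert_p=\big(\sum_{n\ge 1}|a_n|^p\big)^{1/p}$; $L_p(\mu)$ is the space of $\mu$-measurable functions $f$ on $X$ with $\int_X|f|^p\,d\mu<+\infty$, normed by $\Vert f\Vert_p=\big(\int_X|f|^p\,d\mu\big)^{1/p}$. *)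

theory Defs
  imports "HOL-Analysis.Analysis"
begin

text \<open>
  The spaces of real sequences \<open>l_p\<close> and of real-valued functions \<open>L_p(\<mu>)\<close>, for real
  \<open>1 \<le> p\<close>. Sequences are indexed by all of \<^typ>\<open>nat\<close> (starting at 0 rather than at 1).
  Elements of \<open>L_p(\<mu>)\<close> are genuine functions, not classes modulo equality almost everywhere.
  Note that \<open>0 powr a = 0\<close> for every \<open>a\<close>, which is the right value here, since all exponents
  that occur are positive.
\<close>

definition seq_lp :: "real \<Rightarrow> (nat \<Rightarrow> real) set" where
  "seq_lp p = {a. summable (\<lambda>n. \<bar>a n\<bar> powr p)}"

definition seq_lp_norm :: "real \<Rightarrow> (nat \<Rightarrow> real) \<Rightarrow> real" where
  "seq_lp_norm p a = (\<Sum>n. \<bar>a n\<bar> powr p) powr (1 / p)"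

text \<open>
  For a measurable \<open>f\<close>, integrability of the nonnegative function \<open>\<bar>f\<bar> powr p\<close> says exactly that
  its integral is finite.
\<close>

definition fun_Lp :: "real \<Rightarrow> 'a measure \<Rightarrow> ('a \<Rightarrow> real) set" where
  "fun_Lp p M = {f \<in> borel_measurable M. integrable M (\<lambda>t. \<bar>f t\<bar> powr p)}"

definition fun_Lp_norm :: "real \<Rightarrow> 'a measure \<Rightarrow> ('a \<Rightarrow> real) \<Rightarrow> real" where
  "fun_Lp_norm p M f = (\<integral>t. \<bar>f t\<bar> powr p \<partial>M) powr (1 / p)"

end

theory Submission
  imports Defs
begin

text \<open>
  Everything rests on one scalar fact: if \<open>2 (u + v) \<le> X + Y\<close> and \<open>s \<ge> 1\<close>, then
  \<open>2 (u\<^sup>s + v\<^sup>s) \<le> 2 (u + v)\<^sup>s \<le> X\<^sup>s + Y\<^sup>s\<close>, by superadditivity and convexity of \<open>t\<^sup>s\<close>.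
  With \<open>X, Y = (a \<plusminus> b)\<^sup>2\<close>, \<open>u = a\<^sup>2\<close>, \<open>v = b\<^sup>2\<close> and \<open>s = p / 2\<close> it gives the case \<open>p = q\<close>
  pointwise. Integrating, its hypothesis holds for the integrals of \<open>\<bar>x \<plusminus> y\<bar>\<^sup>p\<close>, \<open>\<bar>x\<bar>\<^sup>p\<close> and
  \<open>\<bar>y\<bar>\<^sup>p\<close>, and applying it again with \<open>s = q / p\<close> gives the theorem.
\<close>

text \<open>Factor \<open>w powr s = w * w powr (s - 1)\<close>; since \<open>s - 1 \<ge> 0\<close>,
  each second factor is at most \<open>(u + v) powr (s - 1)\<close>.\<close>

lemma powr_superadditive:
  fixes u v s :: real
  assumes "0 \<le> u" "0 \<le> v" "1 \<le> s"
  shows "u powr s + v powr s \<le> (u + v) powr s"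
proof -
  have split: "w powr s = w * w powr (s - 1)" if "0 \<le> w" for w :: real
    using that powr_add[of w 1 "s - 1"] by (cases "w = 0") auto
  have "u * u powr (s - 1) \<le> u * (u + v) powr (s - 1)"
    and "v * v powr (s - 1) \<le> v * (u + v) powr (s - 1)"
    using assms by (auto intro!: mult_left_mono powr_mono2)
  then show ?thesis
    using assms by (simp add: split algebra_simps)
qed

lemma powr_midpoint_le:
  fixes x y s :: real
  assumes "0 \<le> x" "0 \<le> y" "1 \<le> s"
  shows "2 * ((x + y) / 2) powr s \<le> x powr s + y powr s"
proof (cases "x = 0 \<or> y = 0")
  case True
  then show ?thesis
    \<comment> \<open>With one argument zero, the other is twice the midpoint, so superadditivity
      suffices; convexity is then invoked only at positive points.\<close>
    using powr_superadditive[of "(x + y) / 2" "(x + y) / 2" s] assms by auto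
next
  case False
  then show ?thesis
    using convex_onD[OF powr_convex[of s], of "1/2" x y] assms by (simp add: field_simps)
qed

lemma two_sum_powr_le:
  fixes u v x y s :: real
  assumes "0 \<le> u" "0 \<le> v" "0 \<le> x" "0 \<le> y" "1 \<le> s" "2 * (u + v) \<le> x + y"
  shows "2 * (u powr s + v powr s) \<le> x powr s + y powr s"
proof -
  have "2 * (u powr s + v powr s) \<le> 2 * (u + v) powr s"
    using assms powr_superadditive[of u v s] by simp
  also have "\<dots> \<le> 2 * ((x + y) / 2) powr s"
    using assms by (auto intro!: powr_mono2)
  also have "\<dots> \<le> x powr s + y powr s"
    using assms by (intro powr_midpoint_le)
  finally show ?thesis .
qed

lemma power2_powr_half: "(a\<^sup>2) powr (p / 2) = \<bar>a\<bar> powr p" for a p :: real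
proof -
  have "a\<^sup>2 = \<bar>a\<bar> powr 2"
    by (simp add: powr_numeral)
  then show ?thesis
    by (simp only: powr_powr) simp
qed

text \<open>The parallelogram identity \<open>(a + b)\<^sup>2 + (a - b)\<^sup>2 = 2 * (a\<^sup>2 +
  b\<^sup>2)\<close> supplies the hypothesis of \<open>two_sum_powr_le\<close>, with
  equality.\<close>

lemma clarkson_pointwise:
  fixes a b p :: real
  assumes "2 \<le> p"
  shows "2 * (\<bar>a\<bar> powr p + \<bar>b\<bar> powr p) \<le> \<bar>a + b\<bar> powr p + \<bar>a - b\<bar> powr p"
  using two_sum_powr_le[of "a\<^sup>2" "b\<^sup>2" "(a + b)\<^sup>2" "(a - b)\<^sup>2" "p / 2"] assms
  by (simp add: power2_powr_half) (simp add: power2_eq_square algebra_simps)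

text \<open>Ensures that the integral of \<open>\<bar>x + y\<bar> powr p\<close> is genuine: the
  Bochner integral of a non-integrable function is 0 by default.\<close>

lemma fun_Lp_add:
  assumes "0 \<le> p" "x \<in> fun_Lp p M" "y \<in> fun_Lp p M"
  shows "(\<lambda>t. x t + y t) \<in> fun_Lp p M"
proof -
  have meas [measurable]: "x \<in> borel_measurable M" "y \<in> borel_measurable M"
    and int: "integrable M (\<lambda>t. \<bar>x t\<bar> powr p)" "integrable M (\<lambda>t. \<bar>y t\<bar> powr p)"
    using assms(2,3) by (auto simp: fun_Lp_def)
  have bound: "\<bar>a + b\<bar> powr p \<le> 2 powr p * (\<bar>a\<bar> powr p + \<bar>b\<bar> powr p)" for a b :: real
  proof -
    have "\<bar>a + b\<bar> powr p \<le> (2 * max \<bar>a\<bar> \<bar>b\<bar>) powr p"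
      using assms(1) by (intro powr_mono2) auto
    also have "\<dots> = 2 powr p * max \<bar>a\<bar> \<bar>b\<bar> powr p"
      by (simp add: powr_mult)
    also have "\<dots> \<le> 2 powr p * (\<bar>a\<bar> powr p + \<bar>b\<bar> powr p)"
      by (intro mult_left_mono) (auto simp: max_def)
    finally show ?thesis .
  qed
  have "integrable M (\<lambda>t. 2 powr p * (\<bar>x t\<bar> powr p + \<bar>y t\<bar> powr p))"
    using int by simp
  then have "integrable M (\<lambda>t. \<bar>x t + y t\<bar> powr p)"
    by (rule Bochner_Integration.integrable_bound) (use bound in auto)
  then show ?thesis
    by (simp add: fun_Lp_def)
qed

lemma fun_Lp_diff:
  assumes "0 \<le> p" "x \<in> fun_Lp p M" "y \<in> fun_Lp p M"
  shows "(\<lambda>t. x t - y t) \<in> fun_Lp p M"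
proof -
  have "(\<lambda>t. - y t) \<in> fun_Lp p M"
    using assms(3) by (simp add: fun_Lp_def)
  then show ?thesis
    using fun_Lp_add[OF assms(1,2)] by fastforce
qed

lemma fun_Lp_norm_clarkson:
  assumes "2 \<le> p" "p \<le> q" "x \<in> fun_Lp p M" "y \<in> fun_Lp p M"
  shows "2 * (fun_Lp_norm p M x powr q + fun_Lp_norm p M y powr q)
    \<le> fun_Lp_norm p M (\<lambda>t. x t + y t) powr q + fun_Lp_norm p M (\<lambda>t. x t - y t) powr q"
proof -
  let ?I = "\<lambda>f. \<integral>t. \<bar>f t\<bar> powr p \<partial>M"
  have int: "integrable M (\<lambda>t. \<bar>x t\<bar> powr p)" "integrable M (\<lambda>t. \<bar>y t\<bar> powr p)"
    "integrable M (\<lambda>t. \<bar>x t + y t\<bar> powr p)" "integrable M (\<lambda>t. \<bar>x t - y t\<bar> powr p)"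
    using fun_Lp_add[of p x M y] fun_Lp_diff[of p x M y] assms by (auto simp: fun_Lp_def)
  have "2 * (?I x + ?I y) = (\<integral>t. 2 * (\<bar>x t\<bar> powr p + \<bar>y t\<bar> powr p) \<partial>M)"
    using int by simp
  also have "\<dots> \<le> (\<integral>t. \<bar>x t + y t\<bar> powr p + \<bar>x t - y t\<bar> powr p \<partial>M)"
    using int clarkson_pointwise[OF assms(1)] by (intro integral_mono) auto
  also have "\<dots> = ?I (\<lambda>t. x t + y t) + ?I (\<lambda>t. x t - y t)"
    using int by simp
  \<comment> \<open>The exponent is \<open>q / p \<ge> 1\<close> because the \<open>q\<close>-th
    power of the norm is \<open>?I f powr (q / p)\<close>.\<close>
  finally have "2 * (?I x powr (q / p) + ?I y powr (q / p))
      \<le> ?I (\<lambda>t. x t + y t) powr (q / p) + ?I (\<lambda>t. x t - y t) powr (q / p)"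
    using assms(1,2) by (intro two_sum_powr_le) auto
  then show ?thesis
    by (simp add: fun_Lp_norm_def powr_powr)
qed

text \<open>Sequences are functions on \<open>nat\<close> with counting measure, so the sequence
  case is an instance of the integral one.\<close>

lemma fun_Lp_count_space: "fun_Lp p (count_space UNIV) = seq_lp p"
  by (simp add: fun_Lp_def seq_lp_def integrable_count_space_nat_iff)

lemma fun_Lp_norm_count_space:
  assumes "a \<in> seq_lp p"
  shows "fun_Lp_norm p (count_space UNIV) a = seq_lp_norm p a"
  using assms
  by (simp add: fun_Lp_norm_def seq_lp_norm_def seq_lp_def
      integral_count_space_nat integrable_count_space_nat_iff)

lemma seq_lp_norm_clarkson:
  assumes "2 \<le> p" "p \<le> q" "x \<in> seq_lp p" "y \<in> seq_lp p"
  shows "2 * (seq_lp_norm p x powr q + seq_lp_norm p y powr q)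
    \<le> seq_lp_norm p (\<lambda>n. x n + y n) powr q + seq_lp_norm p (\<lambda>n. x n - y n) powr q"
  using fun_Lp_norm_clarkson[of p q x "count_space UNIV" y]
    \<comment> \<open>Membership of the sum and difference is what lets their norms be
      translated.\<close>
    fun_Lp_add[of p x "count_space UNIV" y] fun_Lp_diff[of p x "count_space UNIV" y] assms
  by (simp add: fun_Lp_count_space fun_Lp_norm_count_space)

theorem theorem1p2:
  fixes p q :: real
  assumes "2 \<le> p" and "p \<le> q"
  shows "(\<forall>x\<in>seq_lp p. \<forall>y\<in>seq_lp p.
            (\<forall>n. 0 \<le> x n) \<longrightarrow> (\<forall>n. 0 \<le> y n) \<longrightarrow>
            2 * (seq_lp_norm p x powr q + seq_lp_norm p y powr q)
              \<le> seq_lp_norm p (\<lambda>n. x n + y n) powr q + seq_lp_norm p (\<lambda>n. x n - y n) powr q)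
       \<and> (\<forall>M :: 'a measure. \<forall>x\<in>fun_Lp p M. \<forall>y\<in>fun_Lp p M.
            (\<forall>t\<in>space M. 0 \<le> x t) \<longrightarrow> (\<forall>t\<in>space M. 0 \<le> y t) \<longrightarrow>
            2 * (fun_Lp_norm p M x powr q + fun_Lp_norm p M y powr q)
              \<le> fun_Lp_norm p M (\<lambda>t. x t + y t) powr q + fun_Lp_norm p M (\<lambda>t. x t - y t) powr q)"
  using assms by (blast intro: seq_lp_norm_clarkson fun_Lp_norm_clarkson)

end
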